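(* Let $n,m\ge 1$ be integers and $0<\alpha<nm$. Let $B$ be a Young function such that $$t^{\frac{\alpha}{nm}}\,B^{-1}\bigl(t^{1-\frac{\alpha}{nm}}\bigr)\le B^{-1}(t)\qquad (t>0),$$ and let $\psi(t)=B\bigl(t^{1-\alpha/(nm)}\bigr)^{nm/(nm-\alpha)}$. For each $i=1,\dots,m$ let $1\le p_i<nm/\alpha$, $\frac1{q_i}=\frac1{p_i}-\frac{\alpha}{nm}$ and $s_i=\bigl(1-\frac{\alpha}{nm}\bigr)q_i$, and let $p,q,s$ be given by $\frac1p=\sum_{i=1}^m\frac1{p_i}$, $\frac1q=\sum_{i=1}^m\frac1{q_i}$, $\frac1s=\sum_{i=1}^m\frac1{s_i}$. Let $w_1,\dots,w_m$ be weights on $\mathbb{R}^n$ and let $f_1,\dots,f_m$ be nonnegative measurable functions on $\mathbb{R}^n$. If $$\vec{f_w}=(f_1/w_1,\dots,f_m/w_m),\qquad \vec g=\bigl(f_1^{p_1/s_1}w_1^{-q_1/s_1},\dots,f_m^{p_m/s_m}w_m^{-q_m/s_m}\bigr),$$ then for every $x\in\mathbb{R}^n$ $$\mathcal{M}_{\alpha,B}\vec{f_w}(x)\le \bigl(\mathcal{M}_{\psi}\vec g(x)\bigr)^{1-\alpha/(nm)}\left(\prod_{i=1}^m\|f_i\|_{L^{p_i}}^{p_i}\right)^{\frac{\alpha}{nm}}.$$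
   Context: A weight is a nonnegative measurable function on $\mathbb{R}^n$; the weights $w_i$ are understood to be positive a.e., since quotients and negative powers occur. A Young function is a function $B:[0,\infty)\to[0,\infty)$ of the form $B(t)=\int_0^t b(s)\,ds$ with $b$ nontrivial, nonnegative and increasing (in the wide sense, so $B(t)=t$ is allowed). Under the hypotheses $\psi$ is also a Young function. For a cube $Q$ (sides parallel to the axes), $\|f\|_{B,Q}=\inf\{\lambda>0:\frac1{|Q|}\int_Q B(|f|/\lambda)\le 1\}$. For $0\le\alpha<nm$ and $\vec f=(f_1,\dots,f_m)$, $\mathcal{M}_{\alpha,B}\vec f(x)=\sup_{Q\ni x}|Q|^{\alpha/n}\prod_{i=1}^m\|f_i\|_{B,Q}$, the supremum being over all cubes $Q$ containing $x$; and $\mathcal{M}_{\psi}=\mathcal{M}_{0,\psi}$. *)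

theory Defs
  imports "HOL-Analysis.Analysis"
begin

definition weight :: "(real ^ 'n \<Rightarrow> real) \<Rightarrow> bool" where
  "weight w \<longleftrightarrow> w \<in> borel_measurable lebesgue \<and> (\<forall>x. 0 \<le> w x) \<and> (AE x in lebesgue. 0 < w x)"

(* Functions on [0, oo) are represented by total functions on the reals whose values at negative
   arguments are irrelevant. *)
definition young_function :: "(real \<Rightarrow> real) \<Rightarrow> bool" where
  "young_function B \<longleftrightarrow>
     (\<exists>b. mono_on {0..} b \<and> (\<forall>s\<ge>0. 0 \<le> b s) \<and> (\<exists>s\<ge>0. b s \<noteq> 0) \<and>
          (\<forall>t\<ge>0. B t = integral {0..t} b))"

(* A Young function B is continuous and unbounded, and strictly increasing where it is positive;
   so every t > 0 has exactly one preimage in [0, oo), although B may vanish near 0. *)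
abbreviation young_inverse :: "(real \<Rightarrow> real) \<Rightarrow> real \<Rightarrow> real" where
  "young_inverse B \<equiv> inv_into {0..} B"

definition is_cube :: "(real ^ 'n) set \<Rightarrow> bool" where
  "is_cube Q \<longleftrightarrow> (\<exists>a l. 0 < l \<and> Q = cbox a (\<chi> i. a $ i + l))"

(* The infimum of the empty set is oo. *)
definition luxemburg_norm :: "(real \<Rightarrow> real) \<Rightarrow> (real ^ 'n) set \<Rightarrow> (real ^ 'n \<Rightarrow> real) \<Rightarrow> ennreal" where
  "luxemburg_norm B Q f =
     (INF r\<in>{r::real. 0 < r \<and>
        (\<integral>\<^sup>+x\<in>Q. ennreal (B (\<bar>f x\<bar> / r)) \<partial>lebesgue) / emeasure lebesgue Q \<le> 1}. ennreal r)"

(* The tuple is (f 1, ..., f m). Products in ennreal follow the convention 0 * oo = 0. *)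
definition multi_maximal ::
    "nat \<Rightarrow> real \<Rightarrow> (real \<Rightarrow> real) \<Rightarrow> (nat \<Rightarrow> real ^ 'n \<Rightarrow> real) \<Rightarrow> real ^ 'n \<Rightarrow> ennreal" where
  "multi_maximal m \<alpha> B f x =
     (SUP Q\<in>{Q. is_cube Q \<and> x \<in> Q}.
        ennreal (measure lebesgue Q powr (\<alpha> / real CARD('n))) *
        (\<Prod>i=1..m. luxemburg_norm B Q (f i)))"

(* Only meant for exponents a > 0, where oo to the power a is oo. *)
definition ennreal_powr :: "ennreal \<Rightarrow> real \<Rightarrow> ennreal" where
  "ennreal_powr x a = (if x = top then top else ennreal (enn2real x powr a))"

definition Lp_norm :: "real \<Rightarrow> (real ^ 'n \<Rightarrow> real) \<Rightarrow> ennreal" where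
  "Lp_norm p f = ennreal_powr (\<integral>\<^sup>+x. ennreal (\<bar>f x\<bar> powr p) \<partial>lebesgue) (1 / p)"

end

theory Submission
  imports Defs
begin

text \<open>
  The hypothesis on \<open>B\<inverse>\<close> forces \<open>B\<close> to be linear.  Put \<open>\<beta> = \<alpha> / (n m)\<close> and \<open>a = B\<inverse>(1)\<close>.
  The hypothesis says that \<open>t / B\<inverse>(t)\<close> does not decrease when \<open>t\<close> is replaced by
  \<open>t powr (1 - \<beta>)\<close>; iterating drives \<open>t > 1\<close> to \<open>1\<close>, so \<open>t / B\<inverse>(t) \<le> 1 / a\<close>.  Convexity gives
  the reverse inequality, so \<open>B v = v / a\<close> for \<open>v \<ge> a\<close>, and convexity together with
  \<open>B 0 = 0\<close> extends this to \<open>[0, a]\<close>.  Hence \<open>\<psi>\<close> is linear too, both Luxemburg norms are multiples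
  of averages, and the claim follows on each cube, for each \<open>i\<close> separately, from Hoelder's inequality
  with exponents \<open>1 / (1 - \<beta>)\<close> and \<open>1 / \<beta>\<close> applied to
  \<open>f i / w i = (g i) powr (1 - \<beta>) * (f i powr P i) powr \<beta>\<close>.
\<close>

section \<open>Young functions: convexity and surjectivity\<close>

text \<open>Since \<open>b\<close> is increasing, its endpoint values bound its integral from both
  sides. Thus \<open>b\<close> selects supporting slopes of the convex function \<open>B\<close>;
  the later facts on Young functions rest on this.\<close>

lemma young_function_increment_bounds:
  assumes "young_function B"
  obtains b where "mono_on {0..} b" "\<And>s. 0 \<le> s \<Longrightarrow> 0 \<le> b s" "\<exists>s\<ge>0. 0 < b s" "B 0 = 0"
    and "\<And>u v. 0 \<le> u \<Longrightarrow> u \<le> v \<Longrightarrow> (v - u) * b u \<le> B v - B u"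
    and "\<And>u v. 0 \<le> u \<Longrightarrow> u \<le> v \<Longrightarrow> B v - B u \<le> (v - u) * b v"
proof -
  obtain b where b: "mono_on {0..} b" "\<And>s. 0 \<le> s \<Longrightarrow> 0 \<le> b s" "\<exists>s\<ge>0. b s \<noteq> 0"
    and Bb: "\<And>t. 0 \<le> t \<Longrightarrow> B t = integral {0..t} b"
    using assms unfolding young_function_def by blast
  \<comment> \<open>Monotonicity makes \<open>b\<close> integrable here, so \<open>integral\<close>
    is never the default value 0 of a non-integrable function.\<close>
  have int: "b integrable_on {u..v}" if "0 \<le> u" for u v
    by (rule integrable_on_mono_on, rule mono_on_subset[OF b(1)]) (use that in auto)
  have diff: "B v - B u = integral {u..v} b" if "0 \<le> u" "u \<le> v" for u v
    using Henstock_Kurzweil_Integration.integral_combine[of 0 u v b] that int by (simp add: Bb)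
  have "(v - u) * b u \<le> B v - B u" "B v - B u \<le> (v - u) * b v" if uv: "0 \<le> u" "u \<le> v" for u v
  proof -
    have "integral {u..v} (\<lambda>_. b u) \<le> integral {u..v} b"
      using uv by (intro integral_le int) (auto intro: mono_onD[OF b(1)])
    then show "(v - u) * b u \<le> B v - B u" using uv by (simp add: diff)
    have "integral {u..v} b \<le> integral {u..v} (\<lambda>_. b v)"
      using uv by (intro integral_le int) (auto intro: mono_onD[OF b(1)])
    then show "B v - B u \<le> (v - u) * b v" using uv by (simp add: diff)
  qed
  moreover have "\<exists>s\<ge>0. 0 < b s" using b(2,3) by force
  moreover have "B 0 = 0" by (simp add: Bb)
  ultimately show ?thesis using b that by blast
qed

lemma young_function_0: "young_function B \<Longrightarrow> B 0 = 0"
  by (meson young_function_increment_bounds)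

text \<open>The chord of \<open>B\<close> from 0 to \<open>u\<close> has slope at most
  \<open>b u\<close>, the chord from \<open>u\<close> to \<open>v\<close> at least
  \<open>b u\<close>; so \<open>B t / t\<close> is increasing. Cleared denominators admit
  \<open>u = 0\<close>.\<close>

lemma young_function_star_shaped:
  assumes B: "young_function B" and uv: "0 \<le> u" "u \<le> v"
  shows "v * B u \<le> u * B v"
proof -
  obtain b where "B 0 = 0"
    and lo: "\<And>u v. 0 \<le> u \<Longrightarrow> u \<le> v \<Longrightarrow> (v - u) * b u \<le> B v - B u"
    and hi: "\<And>u v. 0 \<le> u \<Longrightarrow> u \<le> v \<Longrightarrow> B v - B u \<le> (v - u) * b v"
    using young_function_increment_bounds[OF B] by metis
  then have "B u \<le> u * b u" using hi[of 0 u] uv by simp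
  then have "(v - u) * B u \<le> u * ((v - u) * b u)"
    using uv mult_left_mono[of "B u" "u * b u" "v - u"] by (simp add: algebra_simps)
  also have "\<dots> \<le> u * (B v - B u)"
    using uv lo[of u v] by (intro mult_left_mono) auto
  finally show ?thesis by (simp add: algebra_simps)
qed

lemma young_function_mono:
  assumes B: "young_function B" and uv: "0 \<le> u" "u \<le> v"
  shows "B u \<le> B v"
proof -
  obtain b where "\<And>s. 0 \<le> s \<Longrightarrow> 0 \<le> b s"
    and lo: "\<And>u v. 0 \<le> u \<Longrightarrow> u \<le> v \<Longrightarrow> (v - u) * b u \<le> B v - B u"
    using young_function_increment_bounds[OF B] by metis
  then have "0 \<le> (v - u) * b u" using uv by simp
  then show ?thesis using lo[OF uv] by simp
qed

text \<open>Makes \<open>young_inverse\<close> a true right inverse: \<open>B\<close> is unbounded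
  because some slope is positive, and continuous because slopes are bounded on compact
  intervals.\<close>

lemma young_function_surj:
  assumes B: "young_function B" and t: "0 \<le> t"
  shows "t \<in> B ` {0..}"
proof -
  obtain b where pos: "\<And>s. 0 \<le> s \<Longrightarrow> 0 \<le> b s" "\<exists>s\<ge>0. 0 < b s" and "B 0 = 0"
    and mono: "mono_on {0..} b"
    and lo: "\<And>u v. 0 \<le> u \<Longrightarrow> u \<le> v \<Longrightarrow> (v - u) * b u \<le> B v - B u"
    and hi: "\<And>u v. 0 \<le> u \<Longrightarrow> u \<le> v \<Longrightarrow> B v - B u \<le> (v - u) * b v"
    using young_function_increment_bounds[OF B] by metis
  obtain s where s: "s \<ge> 0" "0 < b s" using pos by blast
  \<comment> \<open>Beyond \<open>s\<close> the growth rate is at least \<open>b s\<close>, so a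
    further distance \<open>t / b s\<close> adds at least \<open>t\<close>.\<close>
  define T where "T = s + t / b s"
  have T: "s \<le> T" "0 \<le> T" using s t by (auto simp: T_def)
  have "t = (T - s) * b s" using s by (simp add: T_def)
  also have "\<dots> \<le> B T - B s" using lo s T by blast
  also have "\<dots> \<le> B T" using young_function_mono[OF B, of 0 s] s \<open>B 0 = 0\<close> by simp
  finally have "t \<le> B T" .
  have *: "\<bar>B v - B u\<bar> \<le> b T * \<bar>v - u\<bar>" if "0 \<le> u" "u \<le> v" "v \<le> T" for u v
  proof -
    have "b v \<le> b T" using that by (intro mono_onD[OF mono]) auto
    then have "(v - u) * b v \<le> (v - u) * b T" using that by (intro mult_left_mono) auto
    then show ?thesis
      using hi[of u v] young_function_mono[OF B, of u v] that by (simp add: algebra_simps)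
  qed
  have "(b T)-lipschitz_on {0..T} B"
  proof (rule lipschitz_onI)
    fix u v assume "u \<in> {0..T}" "v \<in> {0..T}"
    then show "dist (B u) (B v) \<le> b T * dist u v"
      using *[of u v] *[of v u] by (cases "u \<le> v") (auto simp: dist_real_def abs_minus_commute)
  qed (use pos T in auto)
  then have "continuous_on {0..T} B" by (rule lipschitz_on_continuous_on)
  then obtain u where "0 \<le> u" "u \<le> T" "B u = t"
    using IVT'[of B 0 t T] t T \<open>t \<le> B T\<close> \<open>B 0 = 0\<close> by auto
  then show ?thesis by auto
qed

section \<open>Linearity forced by the condition on the inverse\<close>

lemma young_function_linear:
  assumes B: "young_function B" and \<beta>: "0 < \<beta>" "\<beta> < 1"
    and inv: "\<And>t. 0 < t \<Longrightarrow> t powr \<beta> * young_inverse B (t powr (1 - \<beta>)) \<le> young_inverse B t"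
  obtains K where "0 < K" "\<And>t. 0 \<le> t \<Longrightarrow> B t = K * t"
proof -
  let ?g = "young_inverse B"
  have B0: "B 0 = 0" using young_function_0[OF B] .
  have Bg: "B (?g t) = t" "0 \<le> ?g t" if "0 \<le> t" for t
    using young_function_surj[OF B that] f_inv_into_f[of t B "{0..}"] inv_into_into[of t B "{0..}"]
    by auto
  have gpos: "0 < ?g t" if "0 < t" for t
    using Bg[of t] that B0 by (cases "?g t = 0") auto
  define a where "a = ?g 1"
  have a: "0 < a" "B a = 1" using gpos[of 1] Bg[of 1] by (auto simp: a_def)
  \<comment> \<open>If \<open>?g t < a\<close>, star-shapedness with \<open>B a = 1\<close> gives
    \<open>?g t \<ge> a * t \<ge> a\<close>.\<close>
  have ga: "a \<le> ?g t" if "1 \<le> t" for t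
  proof (rule ccontr)
    assume "\<not> a \<le> ?g t"
    then have "a * t \<le> ?g t"
      using young_function_star_shaped[OF B, of "?g t" a] Bg[of t] that a by simp
    moreover have "a * 1 \<le> a * t" using that a by (intro mult_left_mono) auto
    ultimately show False using \<open>\<not> a \<le> ?g t\<close> by simp
  qed
  have step: "t / ?g t \<le> t powr (1 - \<beta>) / ?g (t powr (1 - \<beta>))" if "1 \<le> t" for t
  proof -
    have "t / ?g t \<le> t / (t powr \<beta> * ?g (t powr (1 - \<beta>)))"
      using that inv[of t] gpos[of "t powr (1 - \<beta>)"] gpos[of t] by (intro divide_left_mono) auto
    also have "\<dots> = t powr (1 - \<beta>) / ?g (t powr (1 - \<beta>))"
      using that by (simp add: powr_diff)
    finally show ?thesis .
  qed
  have iter: "t / ?g t \<le> t powr ((1 - \<beta>) ^ k) / ?g (t powr ((1 - \<beta>) ^ k))" if "1 \<le> t" for t k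
  proof (induction k)
    case 0
    then show ?case using that by simp
  next
    case (Suc k)
    have "1 \<le> t powr ((1 - \<beta>) ^ k)" using that \<beta> by (simp add: ge_one_powr_ge_zero)
    from step[OF this] show ?case using Suc by (simp add: powr_powr mult.commute)
  qed
  \<comment> \<open>Replacing the denominator in \<open>iter\<close> by its lower bound
    \<open>a\<close> leaves only a power of \<open>t\<close> to pass to the limit.\<close>
  have bound: "t / ?g t \<le> 1 / a" if "1 \<le> t" for t
  proof (rule LIMSEQ_le_const)
    have "(\<lambda>k. (1 - \<beta>) ^ k) \<longlonglongrightarrow> 0" using \<beta> by (intro LIMSEQ_realpow_zero) auto
    then have "(\<lambda>k. t powr ((1 - \<beta>) ^ k) / a) \<longlonglongrightarrow> t powr 0 / a"
      using that a \<beta> by (intro tendsto_intros) auto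
    then show "(\<lambda>k. t powr ((1 - \<beta>) ^ k) / a) \<longlonglongrightarrow> 1 / a" using that by simp
    have "t / ?g t \<le> t powr ((1 - \<beta>) ^ k) / a" for k
    proof -
      have "1 \<le> t powr ((1 - \<beta>) ^ k)" using that \<beta> by (simp add: ge_one_powr_ge_zero)
      then have "t powr ((1 - \<beta>) ^ k) / ?g (t powr ((1 - \<beta>) ^ k)) \<le> t powr ((1 - \<beta>) ^ k) / a"
        using ga[of "t powr ((1 - \<beta>) ^ k)"] a gpos[of "t powr ((1 - \<beta>) ^ k)"]
        by (intro divide_left_mono) auto
      then show ?thesis using iter[OF that, of k] by simp
    qed
    then show "\<exists>N. \<forall>k\<ge>N. t / ?g t \<le> t powr ((1 - \<beta>) ^ k) / a" by blast
  qed
  \<comment> \<open>Star-shapedness gives \<open>\<ge>\<close>. For \<open>\<le>\<close>,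
    \<open>bound\<close> is applied at the argument \<open>B v\<close>, which is at least 1.\<close>
  have large: "B v = v / a" if "a \<le> v" for v
  proof -
    have "v \<le> a * B v" using young_function_star_shaped[OF B, of a v] a that by simp
    then have ge: "v / a \<le> B v" using a by (simp add: field_simps)
    then have ge1: "1 \<le> B v" using that a by (smt (verit) divide_right_mono divide_self)
    have "B v / ?g (B v) \<le> 1 / a" using bound[OF ge1] .
    then have le: "a * B v \<le> ?g (B v)" using a gpos[of "B v"] ge1 by (simp add: field_simps)
    \<comment> \<open>\<open>?g\<close> picks some preimage of \<open>B v\<close>; two distinct
      preimages of a positive value would make \<open>B t / t\<close> decrease.\<close>
    have "?g (B v) = v"
    proof (rule ccontr)
      assume ne: "?g (B v) \<noteq> v"
      have eq: "B (?g (B v)) = B v" using Bg ge1 by simp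
      show False
      proof (cases "?g (B v) < v")
        case True
        then show False
          using young_function_star_shaped[OF B, of "?g (B v)" v] Bg(2)[of "B v"] ge1 eq by simp
      next
        case False
        then show False
          using young_function_star_shaped[OF B, of v "?g (B v)"] that a ne ge1 eq by simp
      qed
    qed
    then show ?thesis using le ge a by (simp add: field_simps)
  qed
  obtain b where lo: "\<And>u v. 0 \<le> u \<Longrightarrow> u \<le> v \<Longrightarrow> (v - u) * b u \<le> B v - B u"
    and hi: "\<And>u v. 0 \<le> u \<Longrightarrow> u \<le> v \<Longrightarrow> B v - B u \<le> (v - u) * b v"
    using young_function_increment_bounds[OF B] by metis
  \<comment> \<open>The slope at \<open>a\<close> is at most that of the chord from \<open>a\<close>
    to \<open>2 * a\<close>, whose endpoint values are known by now.\<close>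
  have "b a \<le> 1 / a" using lo[of a "2 * a"] large[of "2 * a"] a by (simp add: field_simps)
  \<comment> \<open>From below: moving left from \<open>B a = 1\<close>, the function cannot drop
    faster than at rate \<open>b a\<close>.\<close>
  have small: "B v = v / a" if "0 \<le> v" "v \<le> a" for v
  proof (rule antisym)
    show "B v \<le> v / a" using young_function_star_shaped[OF B that] a by (simp add: field_simps)
    have "1 - B v \<le> (a - v) * b a" using hi[OF that] a by simp
    also have "\<dots> \<le> (a - v) * (1 / a)" using that \<open>b a \<le> 1 / a\<close> by (intro mult_left_mono) auto
    finally show "v / a \<le> B v" using a by (simp add: field_simps)
  qed
  show ?thesis
    using that[of "1 / a"] a large small by (metis divide_inverse mult.commute mult.left_neutral
      linear zero_less_divide_1_iff)
qed

section \<open>Powers of extended nonnegative reals and Hoelder's inequality\<close>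

text \<open>The convention \<open>0 * top = 0\<close> is harmless: if one factor is 0 and the other
  \<open>top\<close>, both sides are 0.\<close>

lemma ennreal_powr_mult:
  assumes "0 < a"
  shows "ennreal_powr (x * y) a = ennreal_powr x a * ennreal_powr y a"
proof (cases "x = top \<or> y = top")
  case True
  then show ?thesis
    by (cases "x = 0 \<or> y = 0")
      (auto simp: ennreal_powr_def ennreal_mult_top ennreal_top_mult ennreal_mult_eq_top_iff
        enn2real_eq_0_iff)
next
  case False
  then have "x * y \<noteq> top" by (auto simp: ennreal_mult_eq_top_iff)
  then show ?thesis using False
    by (simp add: ennreal_powr_def enn2real_mult powr_mult flip: ennreal_mult)
qed

lemma ennreal_powr_one: "ennreal_powr 1 a = 1"
  by (simp add: ennreal_powr_def)

lemma ennreal_powr_prod: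
  assumes "0 < a"
  shows "ennreal_powr (\<Prod>i\<in>I. x i) a = (\<Prod>i\<in>I. ennreal_powr (x i) a)"
  by (induction I rule: infinite_finite_induct)
    (simp_all add: ennreal_powr_mult[OF assms] ennreal_powr_one)

lemma ennreal_powr_mono:
  assumes "0 < a" "x \<le> y"
  shows "ennreal_powr x a \<le> ennreal_powr y a"
proof (cases "y = top")
  case False
  then have "x \<noteq> top" using assms by (auto simp: top_unique)
  then show ?thesis using assms False
    by (auto simp: ennreal_powr_def less_top intro!: ennreal_leI powr_mono2 enn2real_mono)
qed (simp add: ennreal_powr_def)

lemma ennreal_powr_ennreal: "0 \<le> r \<Longrightarrow> ennreal_powr (ennreal r) a = ennreal (r powr a)"
  by (simp add: ennreal_powr_def)

lemma ennreal_powr_Lp_norm: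
  assumes "0 < p"
  shows "ennreal_powr (Lp_norm p f) p = (\<integral>\<^sup>+x. ennreal (\<bar>f x\<bar> powr p) \<partial>lebesgue)"
  using assms by (auto simp: Lp_norm_def ennreal_powr_def powr_powr less_top)

text \<open>Weighted AM-GM for \<open>g / G\<close> and \<open>h / H\<close>, with \<open>G\<close>
  and \<open>H\<close> the integrals, is integrated. Exponents of sum 1, in place of conjugate
  norms, match the factorization in \<open>luxemburg_norm_bound\<close>.\<close>

lemma Holder_nn_integral:
  fixes g h :: "'a \<Rightarrow> real"
  assumes g[measurable]: "g \<in> borel_measurable M" and h[measurable]: "h \<in> borel_measurable M"
    and nonneg: "\<And>x. 0 \<le> g x" "\<And>x. 0 \<le> h x"
    and ab: "0 < a" "0 < b" "a + b = 1"
  shows "(\<integral>\<^sup>+x. ennreal (g x powr a * h x powr b) \<partial>M)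
    \<le> ennreal_powr (\<integral>\<^sup>+x. ennreal (g x) \<partial>M) a * ennreal_powr (\<integral>\<^sup>+x. ennreal (h x) \<partial>M) b"
    (is "?L \<le> ennreal_powr ?G a * ennreal_powr ?H b")
proof -
  \<comment> \<open>A zero integral is split off first: there the right side is 0 even if the other
    integral is infinite, and the integrand vanishes almost everywhere. Otherwise an infinite
    integral makes the right side infinite.\<close>
  consider "?G = 0 \<or> ?H = 0" | "?G \<noteq> 0" "?H \<noteq> 0" "?G = top \<or> ?H = top"
    | "?G \<noteq> 0" "?H \<noteq> 0" "?G \<noteq> top" "?H \<noteq> top" by blast
  then show ?thesis
  proof cases
    case 1
    then have "AE x in M. g x = 0 \<or> h x = 0"
      by (auto simp: nn_integral_0_iff_AE ennreal_eq_0_iff intro: antisym nonneg elim!: eventually_mono)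
    then have "?L = 0" by (auto simp: nn_integral_0_iff_AE elim!: eventually_mono)
    then show ?thesis by simp
  next
    case 2
    then show ?thesis
      by (auto simp: ennreal_powr_def ennreal_mult_top ennreal_top_mult ennreal_eq_0_iff
          enn2real_eq_0_iff powr_eq_0_iff top_unique not_le)
  next
    case 3
    define G where "G = enn2real ?G"
    define H where "H = enn2real ?H"
    have G: "?G = ennreal G" "0 < G" and H: "?H = ennreal H" "0 < H"
      using 3 by (auto simp: G_def H_def less_top enn2real_positive_iff zero_less_iff_neq_zero)
    \<comment> \<open>\<open>c\<close> is the claimed bound; it undoes the normalization by
      \<open>G\<close> and \<open>H\<close>, and after integration its total coefficient is
      \<open>a + b = 1\<close>.\<close>
    define c where "c = G powr a * H powr b"
    have c: "0 < c" using G H by (simp add: c_def)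
    have pt: "g x powr a * h x powr b \<le> c * a / G * g x + c * b / H * h x" for x
    proof (cases "g x = 0 \<or> h x = 0")
      case True
      then show ?thesis using c G H ab nonneg by auto
    next
      case False
      then have "(g x / G) powr a * (h x / H) powr b \<le> a * (g x / G) + b * (h x / H)"
        using G H ab nonneg[of x] by (intro Youngs_inequality_0) (auto simp: less_le)
      then have "c * ((g x / G) powr a * (h x / H) powr b) \<le> c * (a * (g x / G) + b * (h x / H))"
        using c by (intro mult_left_mono) auto
      then show ?thesis
        using G H nonneg by (simp add: c_def powr_divide field_simps)
    qed
    have "?L \<le> (\<integral>\<^sup>+x. ennreal (c * a / G) * ennreal (g x) + ennreal (c * b / H) * ennreal (h x) \<partial>M)"
      using pt c G H ab nonneg
      by (intro nn_integral_mono) (simp flip: ennreal_mult ennreal_plus add: ennreal_leI)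
    also have "\<dots> = ennreal (c * a / G) * ?G + ennreal (c * b / H) * ?H"
      by (simp add: nn_integral_add nn_integral_cmult)
    also have "\<dots> = ennreal (c * a / G * G + c * b / H * H)"
      using c G H ab by (simp flip: ennreal_mult ennreal_plus)
    also have "c * a / G * G + c * b / H * H = c"
      using G H ab by (simp flip: distrib_left)
    finally show ?thesis
      using G H by (simp add: c_def ennreal_powr_ennreal ennreal_mult)
  qed
qed

section \<open>Luxemburg norms for linear Young functions\<close>

text \<open>For \<open>c = 0\<close> the constraint \<open>0 < r\<close> excludes the infimum
  itself, so the upper bound goes through \<open>c + e\<close>.\<close>

lemma Inf_ennreal_pos_ge:
  assumes "0 \<le> c"
  shows "(INF r\<in>{r::real. 0 < r \<and> c \<le> r}. ennreal r) = ennreal c"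
proof (rule antisym)
  show "(INF r\<in>{r::real. 0 < r \<and> c \<le> r}. ennreal r) \<le> ennreal c"
  proof (rule ennreal_le_epsilon)
    fix e :: real assume "0 < e"
    then have "(INF r\<in>{r::real. 0 < r \<and> c \<le> r}. ennreal r) \<le> ennreal (c + e)"
      using assms by (intro INF_lower) auto
    then show "(INF r\<in>{r::real. 0 < r \<and> c \<le> r}. ennreal r) \<le> ennreal c + ennreal e"
      using assms \<open>0 < e\<close> by simp
  qed
qed (auto intro!: INF_greatest ennreal_leI)

text \<open>For linear \<open>B\<close> the constraint on \<open>r\<close> says that
  \<open>r\<close> is at least \<open>K\<close> times the average of the absolute value of
  \<open>f\<close> over \<open>Q\<close>.\<close>

lemma luxemburg_norm_linear:
  assumes f: "f \<in> borel_measurable lebesgue" and Qm: "Q \<in> sets lebesgue"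
    and V: "emeasure lebesgue Q = ennreal V" "0 < V"
    and K: "0 < K" "\<And>t. 0 \<le> t \<Longrightarrow> B t = K * t"
  shows "luxemburg_norm B Q f = ennreal (K / V) * (\<integral>\<^sup>+x\<in>Q. ennreal \<bar>f x\<bar> \<partial>lebesgue)"
proof -
  let ?I = "\<integral>\<^sup>+x\<in>Q. ennreal \<bar>f x\<bar> \<partial>lebesgue"
  have avg: "(\<integral>\<^sup>+x\<in>Q. ennreal (B (\<bar>f x\<bar> / r)) \<partial>lebesgue) / emeasure lebesgue Q
      = ennreal (K / (r * V)) * ?I" if "0 < r" for r
  proof -
    have "(\<integral>\<^sup>+x\<in>Q. ennreal (B (\<bar>f x\<bar> / r)) \<partial>lebesgue)
        = (\<integral>\<^sup>+x. ennreal (K / r) * (ennreal \<bar>f x\<bar> * indicator Q x) \<partial>lebesgue)"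
      using that K by (intro nn_integral_cong) (simp flip: ennreal_mult mult.assoc)
    also have "\<dots> = ennreal (K / r) * ?I"
      using f Qm by (intro nn_integral_cmult borel_measurable_times_ennreal) auto
    finally have *: "(\<integral>\<^sup>+x\<in>Q. ennreal (B (\<bar>f x\<bar> / r)) \<partial>lebesgue) = ennreal (K / r) * ?I" .
    have "ennreal (K / r) * ?I / ennreal V = ennreal (K / r) * inverse (ennreal V) * ?I"
      by (simp add: divide_ennreal_def mult_ac)
    also have "ennreal (K / r) * inverse (ennreal V) = ennreal (K / (r * V))"
      using that K V by (simp add: inverse_ennreal divide_inverse flip: ennreal_mult)
    finally show ?thesis using * V by simp
  qed
  show ?thesis
  proof (cases ?I)
    case (real i)
    have "ennreal (K / (r * V)) * ?I \<le> 1 \<longleftrightarrow> K / V * i \<le> r" if "0 < r" for r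
    proof -
      have "ennreal (K / (r * V)) * ?I = ennreal (K / (r * V) * i)"
        using real that K V by (simp del: times_divide_eq_left flip: ennreal_mult)
      then show ?thesis using that K V by (simp add: field_simps)
    qed
    then have "{r. 0 < r \<and> (\<integral>\<^sup>+x\<in>Q. ennreal (B (\<bar>f x\<bar> / r)) \<partial>lebesgue) / emeasure lebesgue Q \<le> 1}
        = {r. 0 < r \<and> K / V * i \<le> r}"
      using avg by auto
    then show ?thesis
      using Inf_ennreal_pos_ge[of "K / V * i"] real K V
      by (simp add: luxemburg_norm_def del: times_divide_eq_left flip: ennreal_mult)
  next
    \<comment> \<open>An infinite integral admits no \<open>r\<close>, and the infimum of the empty
      set is \<open>top\<close>.\<close>
    case top
    then have "{r. 0 < r \<and> (\<integral>\<^sup>+x\<in>Q. ennreal (B (\<bar>f x\<bar> / r)) \<partial>lebesgue) / emeasure lebesgue Q \<le> 1} = {}"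
      using avg K V by (auto simp: ennreal_mult_top top_unique)
    then show ?thesis using top K V by (simp add: luxemburg_norm_def ennreal_mult_top)
  qed
qed

section \<open>The estimate on one cube for one component\<close>

lemma is_cube_emeasure:
  fixes Q :: "(real ^ 'n) set"
  assumes "is_cube Q"
  shows "Q \<in> sets lebesgue" "emeasure lebesgue Q = ennreal (measure lebesgue Q)"
    "0 < measure lebesgue Q"
proof -
  obtain a :: "real ^ 'n" and l where l: "0 < l" and Q: "Q = cbox a (\<chi> i. a $ i + l)"
    using assms unfolding is_cube_def by blast
  show "Q \<in> sets lebesgue" using Q by simp
  show "emeasure lebesgue Q = ennreal (measure lebesgue Q)"
    unfolding Q by (rule emeasure_eq_measure2) (simp add: fmeasurableD2)
  have "0 < measure lborel Q"
    unfolding Q using l by (intro content_pos_lt) (auto simp: Basis_vec_def inner_axis)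
  then show "0 < measure lebesgue Q" by (simp add: Q)
qed

text \<open>Hoelder's inequality on the cube for one factor of the product. The exponents of
  \<open>f\<close> and \<open>w\<close> are \<open>P i / S i\<close> and
  \<open>- (Q i / S i)\<close> rewritten in terms of \<open>p\<close> and
  \<open>\<beta>\<close>.\<close>

lemma luxemburg_norm_bound:
  fixes f w :: "real ^ 'n \<Rightarrow> real"
  assumes cube: "is_cube Q"
    and \<beta>: "0 < \<beta>" "\<beta> < 1" and p: "0 < p" "p * \<beta> < 1"
    and K: "0 < K" "\<And>t. 0 \<le> t \<Longrightarrow> B t = K * t"
    and \<psi>: "\<And>t. 0 \<le> t \<Longrightarrow> \<psi> t = K powr (1 / (1 - \<beta>)) * t"
    and w: "weight w" and f: "f \<in> borel_measurable lebesgue" "\<And>y. 0 \<le> f y"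
  shows "ennreal (measure lebesgue Q powr \<beta>) * luxemburg_norm B Q (\<lambda>y. f y / w y)
    \<le> ennreal_powr (luxemburg_norm \<psi> Q
          (\<lambda>y. f y powr ((1 - p * \<beta>) / (1 - \<beta>)) * w y powr (- (1 / (1 - \<beta>))))) (1 - \<beta>)
      * ennreal_powr (ennreal_powr (Lp_norm p f) p) \<beta>"
proof -
  define V where "V = measure lebesgue Q"
  define g where "g = (\<lambda>y. f y powr ((1 - p * \<beta>) / (1 - \<beta>)) * w y powr (- (1 / (1 - \<beta>))))"
  define M where "M = restrict_space (lebesgue :: (real ^ 'n) measure) Q"
  have Q: "Q \<in> sets lebesgue" "emeasure lebesgue Q = ennreal V" "0 < V"
    using is_cube_emeasure[OF cube] by (simp_all add: V_def)
  have w_meas [measurable]: "w \<in> borel_measurable lebesgue" and w_nonneg: "\<And>y. 0 \<le> w y"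
    and w_pos: "AE y in lebesgue. 0 < w y"
    using w by (auto simp: weight_def)
  note f(1) [measurable]
  have g_meas [measurable]: "g \<in> borel_measurable lebesgue" unfolding g_def by measurable
  have to_M: "(\<integral>\<^sup>+x\<in>Q. ennreal (u x) \<partial>lebesgue) = (\<integral>\<^sup>+x. ennreal (u x) \<partial>M)" for u
    unfolding M_def using Q(1) by (subst nn_integral_restrict_space) auto
  have M_meas: "u \<in> borel_measurable M" if "u \<in> borel_measurable lebesgue" for u :: "real ^ 'n \<Rightarrow> real"
    unfolding M_def using that by (rule measurable_restrict_space1)
  \<comment> \<open>The exponents of \<open>f\<close> add up to
    \<open>(1 - p * \<beta>) + p * \<beta> = 1\<close>, and that of \<open>w\<close> becomes
    \<open>-1\<close>.\<close>
  have "\<bar>f y / w y\<bar> = g y powr (1 - \<beta>) * (f y powr p) powr \<beta>" if "0 < w y" for y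
  proof (cases "f y = 0")
    case False
    then have "f y powr (1 - p * \<beta>) * f y powr (p * \<beta>) = f y"
      using f(2)[of y] by (simp flip: powr_add)
    moreover have "g y powr (1 - \<beta>) = f y powr (1 - p * \<beta>) / w y"
      using that f(2)[of y] \<beta> by (simp add: g_def powr_divide powr_powr powr_minus_divide)
    ultimately show ?thesis using that f(2)[of y] by (simp add: powr_powr)
  qed (use p \<beta> in \<open>simp add: g_def\<close>)
  then have "(\<integral>\<^sup>+x\<in>Q. ennreal \<bar>f x / w x\<bar> \<partial>lebesgue)
      = (\<integral>\<^sup>+x\<in>Q. ennreal (g x powr (1 - \<beta>) * (f x powr p) powr \<beta>) \<partial>lebesgue)"
    using w_pos by (intro nn_integral_cong_AE) (auto elim!: eventually_mono)
  also have "\<dots> \<le> ennreal_powr (\<integral>\<^sup>+x. ennreal (g x) \<partial>M) (1 - \<beta>)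
      * ennreal_powr (\<integral>\<^sup>+x. ennreal (f x powr p) \<partial>M) \<beta>"
    unfolding to_M using \<beta> by (intro Holder_nn_integral M_meas) (auto simp: g_def)
  \<comment> \<open>Enlarging the cube to the whole space frees this factor from
    \<open>Q\<close>.\<close>
  also have "(\<integral>\<^sup>+x. ennreal (f x powr p) \<partial>M) \<le> (\<integral>\<^sup>+x. ennreal (\<bar>f x\<bar> powr p) \<partial>lebesgue)"
    unfolding to_M[symmetric] using f(2)
    by (intro nn_integral_mono) (auto simp: indicator_def)
  also have "\<dots> = ennreal_powr (Lp_norm p f) p"
    using p by (simp add: ennreal_powr_Lp_norm)
  finally have Holder: "(\<integral>\<^sup>+x\<in>Q. ennreal \<bar>f x / w x\<bar> \<partial>lebesgue)
      \<le> ennreal_powr (\<integral>\<^sup>+x. ennreal (g x) \<partial>M) (1 - \<beta>)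
        * ennreal_powr (ennreal_powr (Lp_norm p f) p) \<beta>"
    using \<beta> by (simp add: ennreal_powr_mono mult_left_mono)
  have norm_B: "luxemburg_norm B Q (\<lambda>y. f y / w y)
      = ennreal (K / V) * (\<integral>\<^sup>+x\<in>Q. ennreal \<bar>f x / w x\<bar> \<partial>lebesgue)"
    by (rule luxemburg_norm_linear) (use Q K in auto)
  have "luxemburg_norm \<psi> Q g
      = ennreal (K powr (1 / (1 - \<beta>)) / V) * (\<integral>\<^sup>+x\<in>Q. ennreal \<bar>g x\<bar> \<partial>lebesgue)"
    by (rule luxemburg_norm_linear) (use Q K \<psi> in auto)
  also have "(\<lambda>x. \<bar>g x\<bar>) = g" by (auto simp: g_def)
  finally have "ennreal_powr (luxemburg_norm \<psi> Q g) (1 - \<beta>)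
      = ennreal ((K powr (1 / (1 - \<beta>)) / V) powr (1 - \<beta>))
        * ennreal_powr (\<integral>\<^sup>+x. ennreal (g x) \<partial>M) (1 - \<beta>)"
    using \<beta> Q by (simp add: ennreal_powr_mult ennreal_powr_ennreal to_M)
  \<comment> \<open>Both norms now carry the same constant \<open>K\<close>, and
    \<open>(1 / V) powr (1 - \<beta>)\<close> yields exactly the factor
    \<open>V powr \<beta>\<close> on the left of the claim.\<close>
  also have "(K powr (1 / (1 - \<beta>)) / V) powr (1 - \<beta>) = V powr \<beta> * (K / V)"
    using \<beta> K Q powr_diff[of V 1 \<beta>] by (simp add: powr_divide powr_powr)
  finally have norm_\<psi>: "ennreal_powr (luxemburg_norm \<psi> Q g) (1 - \<beta>)
      = ennreal (V powr \<beta>) * ennreal (K / V) * ennreal_powr (\<integral>\<^sup>+x. ennreal (g x) \<partial>M) (1 - \<beta>)"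
    using K Q by (simp del: times_divide_eq_right flip: ennreal_mult)
  show ?thesis
    unfolding g_def[symmetric] norm_B norm_\<psi> V_def[symmetric]
    using mult_left_mono[OF Holder, of "ennreal (V powr \<beta>) * ennreal (K / V)"]
    by (simp add: mult.assoc)
qed

section \<open>From single cubes to the maximal functions\<close>

theorem lemma2p1:
  fixes n m :: nat and \<alpha> p q s :: real
    and B \<psi> :: "real \<Rightarrow> real"
    and P Q S :: "nat \<Rightarrow> real"
    and w f :: "nat \<Rightarrow> real ^ 'n \<Rightarrow> real"
    and x :: "real ^ 'n"
  assumes n: "n = CARD('n)"
    and m: "1 \<le> m"
    and \<alpha>: "0 < \<alpha>" "\<alpha> < real n * real m"
    and B: "young_function B"
    and B_inverse: "\<forall>t>0. t powr (\<alpha> / (real n * real m)) *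
              young_inverse B (t powr (1 - \<alpha> / (real n * real m))) \<le> young_inverse B t"
    and \<psi>: "\<forall>t\<ge>0. \<psi> t = B (t powr (1 - \<alpha> / (real n * real m)))
              powr (real n * real m / (real n * real m - \<alpha>))"
    and P: "\<forall>i\<in>{1..m}. 1 \<le> P i \<and> P i < real n * real m / \<alpha>"
    and Q: "\<forall>i\<in>{1..m}. 1 / Q i = 1 / P i - \<alpha> / (real n * real m)"
    and S: "\<forall>i\<in>{1..m}. S i = (1 - \<alpha> / (real n * real m)) * Q i"
    and p: "1 / p = (\<Sum>i=1..m. 1 / P i)"
    and q: "1 / q = (\<Sum>i=1..m. 1 / Q i)"
    and s: "1 / s = (\<Sum>i=1..m. 1 / S i)"
    and w: "\<forall>i\<in>{1..m}. weight (w i)"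
    and f: "\<forall>i\<in>{1..m}. f i \<in> borel_measurable lebesgue \<and> (\<forall>y. 0 \<le> f i y)"
  shows "multi_maximal m \<alpha> B (\<lambda>i y. f i y / w i y) x
    \<le> ennreal_powr
         (multi_maximal m 0 \<psi> (\<lambda>i y. f i y powr (P i / S i) * w i y powr (- (Q i / S i))) x)
         (1 - \<alpha> / (real n * real m))
      * ennreal_powr (\<Prod>i=1..m. ennreal_powr (Lp_norm (P i) (f i)) (P i)) (\<alpha> / (real n * real m))"
proof -
  define \<beta> where "\<beta> = \<alpha> / (real n * real m)"
  let ?g = "\<lambda>i y. f i y powr (P i / S i) * w i y powr (- (Q i / S i))"
  let ?F = "\<lambda>i. ennreal_powr (Lp_norm (P i) (f i)) (P i)"
  have nm: "0 < real n * real m" using \<alpha> by (rule less_trans)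
  have \<beta>: "0 < \<beta>" "\<beta> < 1" using \<alpha> nm by (auto simp: \<beta>_def)
  obtain K where K: "0 < K" "\<And>t. 0 \<le> t \<Longrightarrow> B t = K * t"
    using young_function_linear[OF B \<beta>] B_inverse unfolding \<beta>_def by metis
  have exponent: "real n * real m / (real n * real m - \<alpha>) = 1 / (1 - \<beta>)"
    using less_imp_neq[OF nm] \<alpha> by (simp add: \<beta>_def divide_simps)
  have \<psi>_linear: "\<psi> t = K powr (1 / (1 - \<beta>)) * t" if "0 \<le> t" for t
    using \<psi> that K \<beta> unfolding exponent \<beta>_def[symmetric] by (simp add: powr_mult powr_powr)
  have i_bound: "ennreal (measure lebesgue R powr \<beta>) * luxemburg_norm B R (\<lambda>y. f i y / w i y)
      \<le> ennreal_powr (luxemburg_norm \<psi> R (?g i)) (1 - \<beta>) * ennreal_powr (?F i) \<beta>"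
    if i: "i \<in> {1..m}" and R: "is_cube R" for i R
  proof -
    have Pi: "1 \<le> P i" "P i * \<beta> < 1"
      using P i \<alpha> nm by (auto simp: \<beta>_def field_simps)
    have Qi: "1 / Q i = 1 / P i - \<beta>" using Q i by (simp add: \<beta>_def)
    \<comment> \<open>As \<open>1 / 0 = 0\<close>, positivity of \<open>1 / Q i\<close> rules out
      \<open>Q i = 0\<close>, so \<open>Q i\<close> cancels in \<open>Q i / S i\<close>.\<close>
    moreover have "0 < 1 / P i - \<beta>" using Pi by (simp add: field_simps)
    ultimately have "Q i \<noteq> 0" by auto
    have Si: "S i = (1 - \<beta>) * Q i" using S i by (simp add: \<beta>_def)
    have "P i / S i = P i * (1 / Q i) / (1 - \<beta>)" by (simp add: Si)
    also have "\<dots> = (1 - P i * \<beta>) / (1 - \<beta>)" using Pi by (simp add: Qi right_diff_distrib)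
    finally have PS: "P i / S i = (1 - P i * \<beta>) / (1 - \<beta>)" .
    have QS: "Q i / S i = 1 / (1 - \<beta>)" using \<open>Q i \<noteq> 0\<close> \<beta> by (simp add: Si)
    show ?thesis
      unfolding PS QS using w f i Pi
      by (intro luxemburg_norm_bound[where K = K] R \<beta> K \<psi>_linear) auto
  qed
  have "ennreal (measure lebesgue R powr (\<alpha> / real CARD('n))) *
        (\<Prod>i=1..m. luxemburg_norm B R (\<lambda>y. f i y / w i y))
      \<le> ennreal_powr (multi_maximal m 0 \<psi> ?g x) (1 - \<beta>) * ennreal_powr (\<Prod>i=1..m. ?F i) \<beta>"
    if R: "is_cube R" "x \<in> R" for R
  proof -
    have V: "0 < measure lebesgue R" using is_cube_emeasure[OF R(1)] by simp
    \<comment> \<open>Each of the \<open>m\<close> factors receives an equal share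
      \<open>\<beta>\<close> of the exponent.\<close>
    have "\<alpha> / real CARD('n) = \<beta> * real m" using m by (simp add: \<beta>_def n)
    then have "ennreal (measure lebesgue R powr (\<alpha> / real CARD('n)))
        = (\<Prod>i=1..m. ennreal (measure lebesgue R powr \<beta>))"
      using V by (simp add: ennreal_power powr_powr flip: powr_realpow)
    then have "ennreal (measure lebesgue R powr (\<alpha> / real CARD('n))) *
        (\<Prod>i=1..m. luxemburg_norm B R (\<lambda>y. f i y / w i y))
        = (\<Prod>i=1..m. ennreal (measure lebesgue R powr \<beta>) * luxemburg_norm B R (\<lambda>y. f i y / w i y))"
      by (simp only: prod.distrib)
    also have "\<dots> \<le> (\<Prod>i=1..m. ennreal_powr (luxemburg_norm \<psi> R (?g i)) (1 - \<beta>) * ennreal_powr (?F i) \<beta>)"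
      using R i_bound by (intro prod_mono_ennreal) blast
    also have "\<dots> = ennreal_powr (\<Prod>i=1..m. luxemburg_norm \<psi> R (?g i)) (1 - \<beta>)
        * ennreal_powr (\<Prod>i=1..m. ?F i) \<beta>"
      using \<beta> by (simp add: prod.distrib ennreal_powr_prod)
    \<comment> \<open>The prefactor is now \<open>measure lebesgue R powr 0\<close>, which is 1 as
      the measure is positive (\<open>0 powr 0\<close> is 0), so \<open>R\<close> competes in the
      supremum.\<close>
    also have "(\<Prod>i=1..m. luxemburg_norm \<psi> R (?g i)) \<le> multi_maximal m 0 \<psi> ?g x"
      unfolding multi_maximal_def using R V by (intro SUP_upper2[of R]) auto
    finally show ?thesis
      using \<beta> by (simp add: ennreal_powr_mono mult_right_mono)
  qed
  then show ?thesis
    unfolding \<beta>_def[symmetric] multi_maximal_def[of m \<alpha>] by (intro SUP_least) auto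
qed

end
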